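(* Let $s$ be a transcendent defined on $[0,\infty)$, i.e. a real solution of $s''(t) = 2 s(t)^3 - t\, s(t)$ for all $t \geqslant 0$ with $s(0) = 0$ and $s'(0) \neq 0$. Let $M, T$ be real numbers such that $s(t)^2 \leqslant M$ for all $t \in [0,\infty)$ and $T > 2M$, and put $\lambda = 1 - 2M/T$. Then for each $\lambda$-Airy function $g$ and any consecutive zeros $a < b$ of $g$ in $[T,\infty)$, the function $s$ has a zero between $a$ and $b$, i.e. in the open interval $(a,b)$.
   Context: All functions are real-valued functions of a real variable $t$. For $\lambda > 0$, a $\lambda$-Airy function is a function $g$ satisfying $g''(t) + \lambda t\, g(t) = 0$ for all $t$ in its interval of definition, and in particular for all $t \geqslant 0$. Consecutive zeros $a<b$ of $g$ are points with $g(a) = g(b) = 0$ and $g(t) \neq 0$ for all $t \in (a,b)$. *)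

theory Defs
  imports "HOL-Analysis.Analysis"
begin

text \<open>
  Primed functions are derivatives. All derivatives are taken
  relative to the interval of definition, so they are one-sided at an end point belonging to it.
  Values outside the interval are irrelevant.
\<close>

definition transcendent :: "(real \<Rightarrow> real) \<Rightarrow> bool" where
  "transcendent s \<longleftrightarrow>
     (\<exists>s'. (\<forall>t\<ge>0. (s has_real_derivative s' t) (at t within {0..})) \<and>
           (\<forall>t\<ge>0. (s' has_real_derivative 2 * s t ^ 3 - t * s t) (at t within {0..})) \<and>
           s 0 = 0 \<and> s' 0 \<noteq> 0)"

text \<open>The equation \<open>g'' + lam t g = 0\<close> on an interval \<open>I\<close> (open or closed on the left, bounded
  below or not) that contains the nonnegative half-line. The notion is meant for \<open>lam > 0\<close>.\<close>

definition airy_function_on :: "real \<Rightarrow> real set \<Rightarrow> (real \<Rightarrow> real) \<Rightarrow> bool" where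
  "airy_function_on lam I g \<longleftrightarrow>
     is_interval I \<and> {0..} \<subseteq> I \<and>
     (\<exists>g' g''. (\<forall>t\<in>I. (g has_real_derivative g' t) (at t within I)) \<and>
               (\<forall>t\<in>I. (g' has_real_derivative g'' t) (at t within I)) \<and>
               (\<forall>t\<in>I. g'' t + lam * t * g t = 0))"

definition consecutive_zeros :: "(real \<Rightarrow> real) \<Rightarrow> real \<Rightarrow> real \<Rightarrow> bool" where
  "consecutive_zeros g a b \<longleftrightarrow> a < b \<and> g a = 0 \<and> g b = 0 \<and> (\<forall>t\<in>{a<..<b}. g t \<noteq> 0)"

end

theory Submission
  imports Defs
begin

text \<open>
  The theorem is an instance of Sturm's comparison theorem. Write the equation of \<open>s\<close> as
  \<open>s'' + q s = 0\<close> with \<open>q t = t - 2 (s t)\<^sup>2\<close>. The number \<open>lam = 1 - 2 M / T\<close> is chosen so that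
  \<open>q t \<ge> lam t\<close> holds for \<open>t \<ge> T\<close>, because
  \<open>q t - lam t = 2 M (t / T - 1) + 2 (M - (s t)\<^sup>2)\<close> and both summands are nonnegative.
  If \<open>M > 0\<close>, the inequality is strict for \<open>t > T\<close>. If \<open>M = 0\<close>, then \<open>s\<close> vanishes identically on
  the half-line and there is nothing to show.

  The comparison theorem itself, \<open>sturm_comparison\<close>, rests on the Wronskian
  \<open>W = g' f - g f'\<close> of solutions of \<open>g'' + p g = 0\<close> and \<open>f'' + q f = 0\<close>, for which
  \<open>W' = (q - p) f g\<close>. If \<open>f\<close> had no zero between consecutive zeros \<open>a < b\<close> of \<open>g\<close>, then after
  changes of sign both functions would be positive there, so \<open>W\<close> would increase strictly from \<open>a\<close>
  to \<open>b\<close>. But \<open>W a = g' a * f a \<ge> 0 \<ge> g' b * f b = W b\<close>.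
\<close>

text \<open>Positivity of \<open>g\<close> inside the interval forces \<open>g' a \<ge> 0\<close> and \<open>g' b \<le> 0\<close>, while \<open>f\<close> is
  nonnegative at the end points by continuity. The end values of the Wronskian are therefore ordered
  against its strict growth.\<close>

lemma sturm_positive_solutions_impossible:
  fixes f g f' g' p q :: "real \<Rightarrow> real"
  assumes "a < b"
    and f: "\<And>t. t \<in> {a..b} \<Longrightarrow> (f has_real_derivative f' t) (at t)"
    and f': "\<And>t. t \<in> {a..b} \<Longrightarrow> (f' has_real_derivative - q t * f t) (at t)"
    and g: "\<And>t. t \<in> {a..b} \<Longrightarrow> (g has_real_derivative g' t) (at t)"
    and g': "\<And>t. t \<in> {a..b} \<Longrightarrow> (g' has_real_derivative - p t * g t) (at t)"
    and pq: "\<And>t. t \<in> {a<..<b} \<Longrightarrow> p t < q t"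
    and ends: "g a = 0" "g b = 0"
    and fpos: "\<And>t. t \<in> {a<..<b} \<Longrightarrow> f t > 0"
    and gpos: "\<And>t. t \<in> {a<..<b} \<Longrightarrow> g t > 0"
  shows False
proof -
  have "continuous_on (closure {a<..<b}) f"
    using \<open>a < b\<close> by (intro continuous_at_imp_continuous_on ballI DERIV_isCont[OF f]) auto
  then have f_nonneg: "f t \<ge> 0" if "t \<in> {a..b}" for t
    using continuous_ge_on_closure[of "{a<..<b}" f t 0] that fpos \<open>a < b\<close>
    by (auto simp: less_imp_le)
  \<comment> \<open>A negative slope at \<open>a\<close> would make \<open>g\<close> negative just to the right of \<open>a\<close>. The step
    \<open>min d (b - a) / 2\<close> stays both within reach of the slope and inside the interval.\<close>
  have "g' a \<ge> 0"
  proof (rule ccontr)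
    assume "\<not> g' a \<ge> 0"
    then obtain d where "d > 0" and d: "\<And>h. 0 < h \<Longrightarrow> h < d \<Longrightarrow> g (a + h) < g a"
      using DERIV_neg_dec_right[of g "g' a" a] g[of a] \<open>a < b\<close> by auto
    have "g (a + min d (b - a) / 2) < g a"
      using d \<open>d > 0\<close> \<open>a < b\<close> by (auto simp: min_def)
    moreover have "g (a + min d (b - a) / 2) > 0"
      using \<open>d > 0\<close> \<open>a < b\<close> by (intro gpos) (auto simp: min_def field_simps)
    ultimately show False using ends by simp
  qed
  have "g' b \<le> 0"
  proof (rule ccontr)
    assume "\<not> g' b \<le> 0"
    then obtain d where "d > 0" and d: "\<And>h. 0 < h \<Longrightarrow> h < d \<Longrightarrow> g (b - h) < g b"
      using DERIV_pos_inc_left[of g "g' b" b] g[of b] \<open>a < b\<close> by auto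
    have "g (b - min d (b - a) / 2) < g b"
      using d \<open>d > 0\<close> \<open>a < b\<close> by (auto simp: min_def)
    moreover have "g (b - min d (b - a) / 2) > 0"
      using \<open>d > 0\<close> \<open>a < b\<close> by (intro gpos) (auto simp: min_def field_simps)
    ultimately show False using ends by simp
  qed
  define W where "W t = g' t * f t - g t * f' t" for t
  have W: "(W has_real_derivative (q t - p t) * f t * g t) (at t)" if "t \<in> {a..b}" for t
    unfolding W_def
    by (rule derivative_eq_intros f f' g g' that refl)+ (simp add: algebra_simps)
  obtain z where z: "a < z" "z < b" "W b - W a = (b - a) * ((q z - p z) * f z * g z)"
    using MVT2[of a b W "\<lambda>t. (q t - p t) * f t * g t"] W \<open>a < b\<close> by auto
  have "(q z - p z) * f z * g z > 0"
    using z pq[of z] fpos[of z] gpos[of z] by simp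
  then have "W b > W a"
    using z \<open>a < b\<close> by (metis diff_gt_0_iff_gt mult_pos_pos)
  moreover have "W a \<ge> 0"
    using \<open>g' a \<ge> 0\<close> f_nonneg[of a] \<open>a < b\<close> ends by (simp add: W_def)
  moreover have "W b \<le> 0"
    using \<open>g' b \<le> 0\<close> f_nonneg[of b] \<open>a < b\<close> ends by (simp add: W_def mult_nonpos_nonneg)
  ultimately show False by simp
qed

lemma nonvanishing_on_interval_sign:
  fixes f :: "real \<Rightarrow> real"
  assumes "continuous_on {a<..<b} f" and "\<forall>t\<in>{a<..<b}. f t \<noteq> 0"
  obtains c where "c \<noteq> 0" and "\<And>t. t \<in> {a<..<b} \<Longrightarrow> c * f t > 0"
proof -
  have conn: "connected (f ` {a<..<b})"
    using assms(1) by (intro connected_continuous_image) auto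
  have "(\<forall>t\<in>{a<..<b}. f t > 0) \<or> (\<forall>t\<in>{a<..<b}. f t < 0)"
  proof (rule ccontr)
    assume "\<not> ?thesis"
    then obtain x y where "x \<in> {a<..<b}" "y \<in> {a<..<b}" "f x \<le> 0" "0 \<le> f y"
      by (meson not_less)
    then have "0 \<in> f ` {a<..<b}"
      using connectedD_interval[OF conn, of "f x" "f y" 0] by blast
    then show False using assms(2) by auto
  qed
  then show thesis
    using that[of 1] that[of "-1"] by auto
qed

text \<open>Both equations are linear, so multiplying each solution by a constant of the sign that it has
  on \<open>{a<..<b}\<close> reduces the claim to positive solutions.\<close>

lemma sturm_comparison:
  fixes f g f' g' p q :: "real \<Rightarrow> real"
  assumes zeros: "consecutive_zeros g a b"
    and f: "\<And>t. t \<in> {a..b} \<Longrightarrow> (f has_real_derivative f' t) (at t)"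
    and f': "\<And>t. t \<in> {a..b} \<Longrightarrow> (f' has_real_derivative - q t * f t) (at t)"
    and g: "\<And>t. t \<in> {a..b} \<Longrightarrow> (g has_real_derivative g' t) (at t)"
    and g': "\<And>t. t \<in> {a..b} \<Longrightarrow> (g' has_real_derivative - p t * g t) (at t)"
    and pq: "\<And>t. t \<in> {a<..<b} \<Longrightarrow> p t < q t"
  shows "\<exists>t\<in>{a<..<b}. f t = 0"
proof (rule ccontr)
  assume "\<not> ?thesis"
  then have f_nz: "\<forall>t\<in>{a<..<b}. f t \<noteq> 0" by blast
  have ab: "a < b" and ends: "g a = 0" "g b = 0" and g_nz: "\<forall>t\<in>{a<..<b}. g t \<noteq> 0"
    using zeros by (auto simp: consecutive_zeros_def)
  have "continuous_on {a<..<b} f"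
    by (intro continuous_at_imp_continuous_on ballI DERIV_isCont[OF f]) auto
  moreover have "continuous_on {a<..<b} g"
    by (intro continuous_at_imp_continuous_on ballI DERIV_isCont[OF g]) auto
  ultimately obtain c d where
    c: "\<And>t. t \<in> {a<..<b} \<Longrightarrow> c * f t > 0" and d: "\<And>t. t \<in> {a<..<b} \<Longrightarrow> d * g t > 0"
    using f_nz g_nz nonvanishing_on_interval_sign by metis
  show False
  proof (rule sturm_positive_solutions_impossible
      [of a b "\<lambda>t. c * f t" "\<lambda>t. c * f' t" q "\<lambda>t. d * g t" "\<lambda>t. d * g' t" p])
    fix t assume t: "t \<in> {a..b}"
    show "((\<lambda>t. c * f t) has_real_derivative c * f' t) (at t)"
      using DERIV_cmult[OF f[OF t]] .
    show "((\<lambda>t. c * f' t) has_real_derivative - q t * (c * f t)) (at t)"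
      using DERIV_cmult[OF f'[OF t], of c] by (simp add: algebra_simps)
    show "((\<lambda>t. d * g t) has_real_derivative d * g' t) (at t)"
      using DERIV_cmult[OF g[OF t]] .
    show "((\<lambda>t. d * g' t) has_real_derivative - p t * (d * g t)) (at t)"
      using DERIV_cmult[OF g'[OF t], of d] by (simp add: algebra_simps)
  qed (use ab ends pq c d in auto)
qed

text \<open>The zeros of \<open>g\<close> considered here lie at or beyond \<open>T > 0\<close>, away from the end point of either
  interval of definition, so the derivatives there are two-sided.\<close>

lemma has_real_derivative_at_of_within_superset_halfline:
  fixes f :: "real \<Rightarrow> real"
  assumes "(f has_real_derivative D) (at t within I)" and "{0..} \<subseteq> I" and "t > 0"
  shows "(f has_real_derivative D) (at t)"
proof -
  have "{0<..} \<subseteq> I" using assms(2) by auto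
  then have "(f has_real_derivative D) (at t within {0<..})"
    using assms(1) by (rule has_field_derivative_subset[rotated])
  then show ?thesis
    using at_within_open[of t "{0<..}"] assms(3) by simp
qed

theorem theorem8:
  fixes s g :: "real \<Rightarrow> real" and M T lam a b :: real and I :: "real set"
  assumes "transcendent s"
    and "\<forall>t\<in>{0..}. (s t)\<^sup>2 \<le> M"
    and "T > 2 * M"
    and "lam = 1 - 2 * M / T"
    and "airy_function_on lam I g"
    and "consecutive_zeros g a b"
    and "a \<in> {T..}" and "b \<in> {T..}"
  shows "\<exists>t\<in>{a<..<b}. s t = 0"
proof -
  have ab: "a < b" using assms(6) by (simp add: consecutive_zeros_def)
  have "(s 0)\<^sup>2 \<le> M" using assms(2) by simp
  then have "M \<ge> 0" using order_trans zero_le_power2 by blast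
  then have T: "T > 0" using assms(3) by simp
  have pos: "t > 0" if "t \<in> {a..b}" for t using that assms(7) T by auto
  show ?thesis
  proof (cases "M = 0")
    case True
    have "(a + b) / 2 > 0" using pos[of a] pos[of b] ab by simp
    then have "s ((a + b) / 2) = 0" using assms(2) True by force
    then show ?thesis using ab by (intro bexI[of _ "(a + b) / 2"]) auto
  next
    case False
    then have M: "M > 0" using \<open>M \<ge> 0\<close> by simp
    obtain s' where s: "\<And>t. t \<ge> 0 \<Longrightarrow> (s has_real_derivative s' t) (at t within {0..})"
      and s': "\<And>t. t \<ge> 0 \<Longrightarrow> (s' has_real_derivative 2 * s t ^ 3 - t * s t) (at t within {0..})"
      using assms(1) unfolding transcendent_def by blast
    obtain g' g'' where I: "{0..} \<subseteq> I"
      and g: "\<And>t. t \<in> I \<Longrightarrow> (g has_real_derivative g' t) (at t within I)"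
      and g': "\<And>t. t \<in> I \<Longrightarrow> (g' has_real_derivative g'' t) (at t within I)"
      and airy: "\<And>t. t \<in> I \<Longrightarrow> g'' t + lam * t * g t = 0"
      using assms(5) unfolding airy_function_on_def by blast
    note to_at = has_real_derivative_at_of_within_superset_halfline
    show ?thesis
    proof (rule sturm_comparison[OF assms(6), of s s' "\<lambda>t. t - 2 * (s t)\<^sup>2" g' "\<lambda>t. lam * t"])
      fix t assume "t \<in> {a..b}"
      then have t: "t > 0" "t \<ge> 0" "t \<in> I" using pos[of t] I by auto
      show "(s has_real_derivative s' t) (at t)"
        using to_at[OF s] t by simp
      have "2 * s t ^ 3 - t * s t = - (t - 2 * (s t)\<^sup>2) * s t"
        by (simp add: algebra_simps power2_eq_square power3_eq_cube)
      then show "(s' has_real_derivative - (t - 2 * (s t)\<^sup>2) * s t) (at t)"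
        using to_at[OF s'[of t]] t by simp
      show "(g has_real_derivative g' t) (at t)"
        using to_at[OF g[of t] I] t by simp
      have "g'' t = - (lam * t) * g t" using airy[of t] t by simp
      then show "(g' has_real_derivative - (lam * t) * g t) (at t)"
        using to_at[OF g'[of t] I] t by simp
    next
      fix t assume "t \<in> {a<..<b}"
      then have t: "t > T" using assms(7) by auto
      have "(s t)\<^sup>2 \<le> M" using assms(2) t T by simp
      moreover have "M < M * t / T" using M T t by (simp add: field_simps)
      moreover have "lam * t = t - 2 * (M * t / T)"
        unfolding assms(4) using T by (simp add: field_simps)
      ultimately show "lam * t < t - 2 * (s t)\<^sup>2" by linarith
    qed
  qed
qed

end
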